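(* Let $\phi,\psi,\eta\in L^1(\mathbb T)$, $a\in\mathbb C$, and let $n\in\mathbb N\cup\{0\}$ be such that $D_k[\phi]\ne0$ for $k=0,1,\dots,n+1$. Let $K_n(z,w)=\sum_{j=0}^nQ_j(w)\widehat Q_j(z)$ be the reproducing kernel of the system of bi-orthogonal polynomials on the unit circle associated with $\phi$. Then the semi-framed Toeplitz determinants satisfy $$\frac{\mathscr E_{n+2}[\phi;\psi,\eta;a]}{D_{n+1}[\phi]}=a-\int_{\mathbb T}\left[\int_{\mathbb T}K_n(z_1,z_2)z_2^{-n}\eta(z_2)\frac{dz_2}{2\pi iz_2}\right]z_1^{-n}\psi(z_1)\frac{dz_1}{2\pi iz_1},$$ $$\frac{\mathscr G_{n+2}[\phi;\psi,\eta;a]}{D_{n+1}[\phi]}=a-\int_{\mathbb T}\left[\int_{\mathbb T}K_n(z_1^{-1},z_2^{-1})\eta(z_2)\frac{dz_2}{2\pi iz_2}\right]\psi(z_1)\frac{dz_1}{2\pi iz_1},$$ $$\frac{\mathscr H_{n+2}[\phi;\psi,\eta;a]}{D_{n+1}[\phi]}=a-\int_{\mathbb T}\left[\int_{\mathbb T}K_n(z_1^{-1},z_2)z_2^{-n}\eta(z_2)\frac{dz_2}{2\pi iz_2}\right]\psi(z_1)\frac{dz_1}{2\pi iz_1},$$ $$\frac{\mathscr L_{n+2}[\phi;\psi,\eta;a]}{D_{n+1}[\phi]}=a-\int_{\mathbb T}\left[\int_{\mathbb T}K_n(z_1,z_2^{-1})\eta(z_2)\frac{dz_2}{2\pi iz_2}\right]z_1^{-n}\psi(z_1)\frac{dz_1}{2\pi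 iz_1}.$$
   Context: $\mathbb T$ is the unit circle oriented counterclockwise. For $f\in L^1(\mathbb T)$, $f_j=\int_{\mathbb T}f(\zeta)\zeta^{-j}\frac{d\zeta}{2\pi i\zeta}$. $D_N[\phi]=\det(\phi_{j-k})_{0\le j,k\le N-1}$, $D_0[\phi]=1$. Bi-orthogonal polynomials: $Q_k,\widehat Q_k$ are polynomials of degree $k$ with the same leading coefficient $\varkappa_k=\sqrt{D_k[\phi]/D_{k+1}[\phi]}$ satisfying $\int_{\mathbb T}Q_k(\zeta)\widehat Q_m(\zeta^{-1})\phi(\zeta)\frac{d\zeta}{2\pi i\zeta}=\delta_{km}$ (here for $0\le k,m\le n$). Semi-framed determinants: for $N\ge2$ each of $\mathscr E_N,\mathscr G_N,\mathscr H_N,\mathscr L_N[\phi;\psi,\eta;a]$ is the determinant of an $N\times N$ matrix whose upper-left $(N-1)\times(N-1)$ block is $(\phi_{j-k})_{0\le j,k\le N-2}$, whose lower-right entry is $a$, and whose remaining last-column entries (row $j$, $0\le j\le N-2$) and last-row entries (column $k$, $0\le k\le N-2$) are: for $\mathscr E_N$: $\psi_{N-2-j}$ and $\eta_{N-2-k}$; for $\mathscr G_N$: $\psi_j$ and $\eta_k$; for $\mathscr H_N$: $\psi_j$ and $\eta_{N-2-k}$; for $\mathscr L_N$: $\psi_{N-2-j}$ and $\eta_k$. *)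

theory Defs
  imports
    "HOL-Complex_Analysis.Contour_Integration"
    "HOL-Computational_Algebra.Polynomial"
    "Jordan_Normal_Form.Determinant"
begin

hide_const (open) Determinants.det
hide_const (open) Finite_Cartesian_Product.mat

text \<open>\<^term>\<open>circlepath 0 1\<close> traverses the unit circle once, counterclockwise, with constant
  speed on \<^term>\<open>{0..1::real}\<close>, so absolute (Lebesgue) integrability of the pullback is
  membership in \<open>L\<^sup>1\<close> of the circle.\<close>

definition L1_circle :: "(complex \<Rightarrow> complex) \<Rightarrow> bool" where
  "L1_circle f \<longleftrightarrow> (\<lambda>t. f (circlepath 0 1 t)) absolutely_integrable_on {0..1}"

definition circle_integral :: "(complex \<Rightarrow> complex) \<Rightarrow> complex" where
  "circle_integral f = contour_integral (circlepath 0 1) (\<lambda>\<zeta>. f \<zeta> / (2 * of_real pi * \<i> * \<zeta>))"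

definition fourier_coeff :: "(complex \<Rightarrow> complex) \<Rightarrow> int \<Rightarrow> complex" where
  "fourier_coeff f j = circle_integral (\<lambda>\<zeta>. f \<zeta> * \<zeta> powi (- j))"

text \<open>For \<open>N = 0\<close> this is the determinant of the empty matrix, that is, 1.\<close>

definition toeplitz_det :: "nat \<Rightarrow> (complex \<Rightarrow> complex) \<Rightarrow> complex" where
  "toeplitz_det N \<phi> = det (mat N N (\<lambda>(j, k). fourier_coeff \<phi> (int j - int k)))"

text \<open>The \<open>N \<times> N\<close> Toeplitz block bordered by the last column \<open>c\<close>, the last row \<open>r\<close> and the corner
  \<open>a\<close>; intended for \<open>N \<ge> 2\<close>.\<close>

definition semi_framed_det ::
  "nat \<Rightarrow> (complex \<Rightarrow> complex) \<Rightarrow> (nat \<Rightarrow> complex) \<Rightarrow> (nat \<Rightarrow> complex) \<Rightarrow> complex \<Rightarrow> complex" where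
  "semi_framed_det N \<phi> c r a = det (mat N N (\<lambda>(j, k).
     if j < N - 1 \<and> k < N - 1 then fourier_coeff \<phi> (int j - int k)
     else if j < N - 1 then c j
     else if k < N - 1 then r k
     else a))"

definition framed_E ::
  "nat \<Rightarrow> (complex \<Rightarrow> complex) \<Rightarrow> (complex \<Rightarrow> complex) \<Rightarrow> (complex \<Rightarrow> complex) \<Rightarrow> complex \<Rightarrow> complex" where
  "framed_E N \<phi> \<psi> \<eta> a = semi_framed_det N \<phi>
     (\<lambda>j. fourier_coeff \<psi> (int N - 2 - int j)) (\<lambda>k. fourier_coeff \<eta> (int N - 2 - int k)) a"

definition framed_G ::
  "nat \<Rightarrow> (complex \<Rightarrow> complex) \<Rightarrow> (complex \<Rightarrow> complex) \<Rightarrow> (complex \<Rightarrow> complex) \<Rightarrow> complex \<Rightarrow> complex" where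
  "framed_G N \<phi> \<psi> \<eta> a = semi_framed_det N \<phi>
     (\<lambda>j. fourier_coeff \<psi> (int j)) (\<lambda>k. fourier_coeff \<eta> (int k)) a"

definition framed_H ::
  "nat \<Rightarrow> (complex \<Rightarrow> complex) \<Rightarrow> (complex \<Rightarrow> complex) \<Rightarrow> (complex \<Rightarrow> complex) \<Rightarrow> complex \<Rightarrow> complex" where
  "framed_H N \<phi> \<psi> \<eta> a = semi_framed_det N \<phi>
     (\<lambda>j. fourier_coeff \<psi> (int j)) (\<lambda>k. fourier_coeff \<eta> (int N - 2 - int k)) a"

definition framed_L ::
  "nat \<Rightarrow> (complex \<Rightarrow> complex) \<Rightarrow> (complex \<Rightarrow> complex) \<Rightarrow> (complex \<Rightarrow> complex) \<Rightarrow> complex \<Rightarrow> complex" where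
  "framed_L N \<phi> \<psi> \<eta> a = semi_framed_det N \<phi>
     (\<lambda>j. fourier_coeff \<psi> (int N - 2 - int j)) (\<lambda>k. fourier_coeff \<eta> (int k)) a"

text \<open>The common leading coefficient is a square root of the complex number \<open>D\<^sub>k / D\<^sub>k\<^sub>+\<^sub>1\<close>.
  No branch is singled out: each \<open>k\<close> may use either root.\<close>

definition biorthogonal_system ::
  "(complex \<Rightarrow> complex) \<Rightarrow> nat \<Rightarrow> (nat \<Rightarrow> complex poly) \<Rightarrow> (nat \<Rightarrow> complex poly) \<Rightarrow> bool" where
  "biorthogonal_system \<phi> n Q Qh \<longleftrightarrow>
     (\<forall>k\<le>n. degree (Q k) = k \<and> degree (Qh k) = k \<and>
        lead_coeff (Q k) = lead_coeff (Qh k) \<and>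
        (lead_coeff (Q k))\<^sup>2 = toeplitz_det k \<phi> / toeplitz_det (k + 1) \<phi>) \<and>
     (\<forall>k\<le>n. \<forall>m\<le>n.
        circle_integral (\<lambda>\<zeta>. poly (Q k) \<zeta> * poly (Qh m) (inverse \<zeta>) * \<phi> \<zeta>)
          = (if k = m then 1 else 0))"

definition reproducing_kernel ::
  "(nat \<Rightarrow> complex poly) \<Rightarrow> (nat \<Rightarrow> complex poly) \<Rightarrow> nat \<Rightarrow> complex \<Rightarrow> complex \<Rightarrow> complex" where
  "reproducing_kernel Q Qh n z w = (\<Sum>j\<le>n. poly (Q j) w * poly (Qh j) z)"

lemma circle_integral_eq:
  "circle_integral f = integral {0..1} (\<lambda>t. f (circlepath 0 1 t))"
proof -
  have nz: "circlepath 0 1 t \<noteq> 0" for t by (simp add: circlepath)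
  have vd: "vector_derivative (circlepath 0 1) (at t) = 2 * of_real pi * \<i> * circlepath 0 1 t" for t
    by (simp add: vector_derivative_circlepath) (simp add: circlepath)
  show ?thesis unfolding circle_integral_def contour_integral_integral vd
    by (simp add: nz)
qed

lemma L1_circle_mult_powi:
  assumes "L1_circle f"
  shows "(\<lambda>t. f (circlepath 0 1 t) * circlepath 0 1 t powi i) absolutely_integrable_on {0..1}"
proof -
  have nz: "circlepath 0 1 t \<noteq> 0" for t by (simp add: circlepath)
  have c: "continuous_on {0..1} (\<lambda>t. circlepath 0 1 t powi i)"
    by (intro continuous_intros) (auto simp: nz circlepath intro!: continuous_intros)
  have "(\<lambda>t. circlepath 0 1 t powi i * f (circlepath 0 1 t)) absolutely_integrable_on {0..1}"
  proof (rule absolutely_integrable_bounded_measurable_product[where h="(*)"])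
    show "bilinear ((*) :: complex \<Rightarrow> complex \<Rightarrow> complex)" by (rule bilinear_times)
    show "(\<lambda>t. circlepath 0 1 t powi i) \<in> borel_measurable (lebesgue_on {0..1})"
      by (rule continuous_imp_measurable_on_sets_lebesgue[OF c]) simp
    show "bounded ((\<lambda>t. circlepath 0 1 t powi i) ` {0..1})"
      by (intro compact_imp_bounded compact_continuous_image c) simp
    show "(\<lambda>t. f (circlepath 0 1 t)) absolutely_integrable_on {0..1}"
      using assms by (simp add: L1_circle_def)
  qed simp
  then show ?thesis by (simp add: mult.commute)
qed

lemma pairing_eq:
  assumes f: "L1_circle f"
  shows "circle_integral (\<lambda>\<zeta>. poly P \<zeta> * poly R (inverse \<zeta>) * f \<zeta>) =
    (\<Sum>j\<le>degree P. \<Sum>i\<le>degree R. coeff P j * coeff R i * fourier_coeff f (int i - int j))"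
proof -
  let ?g = "circlepath 0 1"
  have nz: "?g t \<noteq> 0" for t by (simp add: circlepath)
  have *: "poly P \<zeta> * poly R (inverse \<zeta>) * f \<zeta> =
    (\<Sum>j\<le>degree P. \<Sum>i\<le>degree R. coeff P j * coeff R i * (f \<zeta> * \<zeta> powi (- (int i - int j))))"
    if "\<zeta> \<noteq> 0" for \<zeta>
    unfolding poly_altdef sum_distrib_right
    using that by (intro sum.cong refl) (simp add: sum_distrib_left power_int_diff field_simps)
  have I: "(\<lambda>t. f (?g t) * ?g t powi i) integrable_on {0..1}" for i
    using L1_circle_mult_powi[OF f] absolutely_integrable_on_def by blast
  show ?thesis
    unfolding circle_integral_eq fourier_coeff_def *[OF nz]
    by (subst integral_sum, simp, intro integrable_sum integrable_on_mult_right I finite_atMost,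
        intro sum.cong refl, subst integral_sum, simp, intro integrable_on_mult_right I,
        intro sum.cong refl integral_mult_right)
qed

text \<open>Non-vanishing of the Toeplitz determinants guarantees that a bi-orthogonal system exists, so a
  statement quantified over all such systems is not vacuous.\<close>

lemma biorthogonal_system_exists:
  assumes f: "L1_circle \<phi>" and D: "\<And>k. k \<le> n + 1 \<Longrightarrow> toeplitz_det k \<phi> \<noteq> 0"
  shows "\<exists>Q Qh. biorthogonal_system \<phi> n Q Qh"
proof -
  define D' where "D' = (\<lambda>k. toeplitz_det k \<phi>)"
  define A where "A = (\<lambda>k. mat (Suc k) (Suc k) (\<lambda>(j, k). fourier_coeff \<phi> (int j - int k)))"
  define s where "s = (\<lambda>k. csqrt (1 / (D' k * D' (Suc k))))"
  define Q where "Q = (\<lambda>k. \<Sum>j\<le>k. monom (s k * adj_mat (A k) $$ (j, k)) j)"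
  define R where "R = (\<lambda>k. \<Sum>j\<le>k. monom (s k * adj_mat (A k) $$ (k, j)) j)"
  have A: "A k \<in> carrier_mat (Suc k) (Suc k)" for k by (simp add: A_def)
  have detA: "det (A k) = D' (Suc k)" for k by (simp add: A_def D'_def toeplitz_det_def)
  have top: "adj_mat (A k) $$ (k, k) = D' k" for k
  proof -
    have "mat_delete (A k) k k = mat k k (\<lambda>(j, k). fourier_coeff \<phi> (int j - int k))"
      by (rule eq_matI) (auto simp: mat_delete_def A_def)
    then show ?thesis
      by (simp add: adj_mat_def A_def cofactor_def D'_def toeplitz_det_def flip: mult_2)
  qed
  have s2: "s k ^ 2 = 1 / (D' k * D' (Suc k))" for k by (simp add: s_def)
  have cQ: "coeff (Q k) j = (if j \<le> k then s k * adj_mat (A k) $$ (j, k) else 0)" for k j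
    by (simp add: Q_def coeff_sum coeff_monom)
  have cR: "coeff (R k) j = (if j \<le> k then s k * adj_mat (A k) $$ (k, j) else 0)" for k j
    by (simp add: R_def coeff_sum coeff_monom)
  have Dn: "D' k \<noteq> 0" "D' (Suc k) \<noteq> 0" if "k \<le> n" for k using D[of k] D[of "Suc k"] that by (auto simp: D'_def)
  have sn: "s k \<noteq> 0" if "k \<le> n" for k using Dn[OF that] by (auto simp: s_def)
  have dQ: "degree (Q k) = k" if "k \<le> n" for k
    by (rule antisym, rule degree_le, simp add: cQ, rule le_degree, simp add: cQ top Dn sn that)
  have dR: "degree (R k) = k" if "k \<le> n" for k
    by (rule antisym, rule degree_le, simp add: cR, rule le_degree, simp add: cR top Dn sn that)
  have colQ: "(\<Sum>j\<le>k. coeff (Q k) j * fourier_coeff \<phi> (int i - int j)) = (if i = k then s k * D' (Suc k) else 0)"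
    if "i \<le> k" for i k
  proof -
    have "(A k * adj_mat (A k)) $$ (i, k) = (\<Sum>j\<le>k. fourier_coeff \<phi> (int i - int j) * adj_mat (A k) $$ (j, k))"
      using that adj_mat(1)[OF A[of k]]
      by (simp add: scalar_prod_def A_def atLeast0LessThan lessThan_Suc_atMost)
    then show ?thesis using that by (simp add: adj_mat(2)[OF A] detA cQ mult.assoc sum_distrib_left[symmetric] mult.commute[of _ "fourier_coeff _ _"] mult.left_commute[of _ "s k"] split: if_splits)
  qed
  have rowR: "(\<Sum>i\<le>k. coeff (R k) i * fourier_coeff \<phi> (int i - int j)) = (if j = k then s k * D' (Suc k) else 0)"
    if "j \<le> k" for j k
  proof -
    have "(adj_mat (A k) * A k) $$ (k, j) = (\<Sum>i\<le>k. adj_mat (A k) $$ (k, i) * fourier_coeff \<phi> (int i - int j))"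
      using that adj_mat(1)[OF A[of k]]
      by (simp add: scalar_prod_def A_def atLeast0LessThan lessThan_Suc_atMost)
    then show ?thesis using that by (simp add: adj_mat(3)[OF A] detA cR mult.assoc sum_distrib_left[symmetric] split: if_splits)
  qed
  have orth: "circle_integral (\<lambda>\<zeta>. poly (Q k) \<zeta> * poly (R m) (inverse \<zeta>) * \<phi> \<zeta>) = (if k = m then 1 else 0)"
    if k: "k \<le> n" and m: "m \<le> n" for k m
  proof (cases "m \<le> k")
    case True
    have "circle_integral (\<lambda>\<zeta>. poly (Q k) \<zeta> * poly (R m) (inverse \<zeta>) * \<phi> \<zeta>)
       = (\<Sum>i\<le>m. \<Sum>j\<le>k. coeff (Q k) j * coeff (R m) i * fourier_coeff \<phi> (int i - int j))"
      unfolding pairing_eq[OF f] dQ[OF k] dR[OF m] by (rule sum.swap)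
    also have "\<dots> = (\<Sum>i\<le>m. coeff (R m) i * (\<Sum>j\<le>k. coeff (Q k) j * fourier_coeff \<phi> (int i - int j)))"
      by (simp add: sum_distrib_left mult_ac)
    also have "\<dots> = (\<Sum>i\<le>m. coeff (R m) i * (if i = k then s k * D' (Suc k) else 0))"
      using True by (intro sum.cong refl) (simp add: colQ)
    also have "\<dots> = (if k = m then s k ^ 2 * D' k * D' (Suc k) else 0)"
      using True by (auto simp: cR top power2_eq_square mult_ac if_distrib[of "(*) _"] cong: if_cong)
    finally show ?thesis using Dn[OF k] by (cases "k = m") (simp_all add: s2)
  next
    case False
    have "circle_integral (\<lambda>\<zeta>. poly (Q k) \<zeta> * poly (R m) (inverse \<zeta>) * \<phi> \<zeta>)
       = (\<Sum>j\<le>k. coeff (Q k) j * (\<Sum>i\<le>m. coeff (R m) i * fourier_coeff \<phi> (int i - int j)))"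
      unfolding pairing_eq[OF f] dQ[OF k] dR[OF m] by (simp add: sum_distrib_left mult_ac)
    also have "\<dots> = 0" using False by (intro sum.neutral) (simp add: rowR)
    finally show ?thesis using False by simp
  qed
  have lc: "(s k * D' k)\<^sup>2 = toeplitz_det k \<phi> / toeplitz_det (k + 1) \<phi>" if "k \<le> n" for k
    using Dn[OF that] by (simp add: power_mult_distrib s2 power2_eq_square[of "D' k"]) (simp add: D'_def)
  have "biorthogonal_system \<phi> n Q R"
    unfolding biorthogonal_system_def using lc by (simp add: dQ dR orth cQ cR top)
  then show ?thesis by blast
qed

end

(* Biorthogonality says that the coefficient matrices of Qh and Q satisfy R T Q^t = 1, where T is
   the Toeplitz matrix of size n + 1. Hence T^{-1} = Q^t R, which is exactly the coefficient matrix
   of the kernel K_n. The Schur complement formula for bordered determinants gives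
   a - r T^{-1} c, and integrating the kernel term by term against \<psi> and \<eta> gives the
   bilinear form r T^{-1} c in their Fourier coefficients. *)

theory Submission
  imports Defs
begin

text \<open>The path never meets 0, so the value of the integrand there is irrelevant. This makes
  the laws for \<open>powi\<close> that fail at 0 usable under the integral.\<close>

lemma circle_integral_cong:
  assumes "\<And>z. z \<noteq> 0 \<Longrightarrow> f z = g z"
  shows "circle_integral f = circle_integral g"
proof -
  have "circlepath 0 1 t \<noteq> 0" for t by (simp add: circlepath)
  then show ?thesis using assms by (simp add: circle_integral_eq)
qed

text \<open>Multiplying an integrable function by an integer power keeps it integrable on the
  circle, so the finite sum comes out of the integral. The sign flips because
  \<open>fourier_coeff f j\<close> integrates against the power \<open>- j\<close>.\<close>

lemma circle_integral_laurent_mult: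
  assumes f: "L1_circle f" and S: "finite S"
  shows "circle_integral (\<lambda>z. (\<Sum>s\<in>S. c s * z powi e s) * f z) =
    (\<Sum>s\<in>S. c s * fourier_coeff f (- e s))"
proof -
  let ?g = "circlepath 0 1"
  have I: "(\<lambda>t. f (?g t) * ?g t powi i) integrable_on {0..1}" for i
    using L1_circle_mult_powi[OF f] absolutely_integrable_on_def by blast
  have "circle_integral (\<lambda>z. (\<Sum>s\<in>S. c s * z powi e s) * f z) =
      integral {0..1} (\<lambda>t. \<Sum>s\<in>S. c s * (f (?g t) * ?g t powi e s))"
    unfolding circle_integral_eq by (simp add: sum_distrib_left mult_ac)
  also have "\<dots> = (\<Sum>s\<in>S. integral {0..1} (\<lambda>t. c s * (f (?g t) * ?g t powi e s)))"
    by (intro integral_sum S integrable_on_mult_right I)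
  also have "\<dots> = (\<Sum>s\<in>S. c s * fourier_coeff f (- e s))"
    unfolding fourier_coeff_def circle_integral_eq
    by (intro sum.cong refl) (simp add: integral_mult_right)
  finally show ?thesis .
qed

text \<open>For fixed \<open>z1\<close> the inner integral evaluates to a Laurent polynomial in
  \<open>z1\<close>, so the formula for a single integral applies twice.\<close>

lemma circle_integral_double_laurent:
  fixes n m :: nat
  assumes \<psi>: "L1_circle \<psi>" and \<eta>: "L1_circle \<eta>"
  shows "circle_integral (\<lambda>z1. circle_integral (\<lambda>z2.
      (\<Sum>i\<le>n. \<Sum>j\<le>m. G j i * z2 powi e j * z1 powi d i) * \<eta> z2) * \<psi> z1) =
    (\<Sum>i\<le>n. \<Sum>j\<le>m. fourier_coeff \<eta> (- e j) * G j i * fourier_coeff \<psi> (- d i))"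
proof -
  have inner: "circle_integral (\<lambda>z2. (\<Sum>i\<le>n. \<Sum>j\<le>m. G j i * z2 powi e j * z1 powi d i) * \<eta> z2) =
      (\<Sum>i\<le>n. (\<Sum>j\<le>m. G j i * fourier_coeff \<eta> (- e j)) * z1 powi d i)" (is "?L = _") for z1
  proof -
    \<comment> \<open>Grouped by powers of \<open>z2\<close>, the powers of \<open>z1\<close> become
      constant coefficients.\<close>
    have "?L = circle_integral (\<lambda>z2. (\<Sum>j\<le>m. (\<Sum>i\<le>n. G j i * z1 powi d i) * z2 powi e j) * \<eta> z2)"
      by (subst sum.swap) (simp add: sum_distrib_left sum_distrib_right mult_ac)
    also have "\<dots> = (\<Sum>j\<le>m. (\<Sum>i\<le>n. G j i * z1 powi d i) * fourier_coeff \<eta> (- e j))"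
      by (rule circle_integral_laurent_mult[OF \<eta> finite_atMost])
    also have "\<dots> = (\<Sum>i\<le>n. (\<Sum>j\<le>m. G j i * fourier_coeff \<eta> (- e j)) * z1 powi d i)"
      by (simp only: sum_distrib_right, subst sum.swap) (simp add: mult_ac)
    finally show ?thesis .
  qed
  show ?thesis
    unfolding inner by (subst circle_integral_laurent_mult[OF \<psi>]) (simp_all add: sum_distrib_left mult_ac)
qed

text \<open>Schur complement: column operations, collected in a matrix of determinant 1, clear the
  border column and leave a block triangular matrix.\<close>

lemma det_bordered:
  fixes A B c r D :: "'a :: idom mat"
  assumes A: "A \<in> carrier_mat m m" and B: "B \<in> carrier_mat m m"
    and c: "c \<in> carrier_mat m 1" and r: "r \<in> carrier_mat 1 m" and D: "D \<in> carrier_mat 1 1"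
    and AB: "A * B = 1\<^sub>m m"
  shows "det (four_block_mat A c r D) = det A * (D $$ (0, 0) - (r * (B * c)) $$ (0, 0))"
proof -
  \<comment> \<open>The upper-right block is chosen so that the border column of the product is
    \<open>A * - (B * c) + c\<close>, which vanishes because \<open>A * B\<close> is the
    identity.\<close>
  let ?N = "four_block_mat (1\<^sub>m m) (- (B * c)) (0\<^sub>m 1 m) (1\<^sub>m 1)"
  have N: "?N \<in> carrier_mat (m + 1) (m + 1)" by (intro four_block_carrier_mat) auto
  have M: "four_block_mat A c r D \<in> carrier_mat (m + 1) (m + 1)"
    using A D by (rule four_block_carrier_mat)
  have Bc: "B * c \<in> carrier_mat m 1" using B c by simp
  have "A * - (B * c) = - c"
    using A B c Bc AB by (simp add: assoc_mult_mat[symmetric])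
  then have z: "A * - (B * c) + c * 1\<^sub>m 1 = 0\<^sub>m m 1"
    using c by (simp add: uminus_l_inv_mat)
  have "four_block_mat A c r D * ?N =
      four_block_mat (A * 1\<^sub>m m + c * 0\<^sub>m 1 m) (A * - (B * c) + c * 1\<^sub>m 1)
        (r * 1\<^sub>m m + D * 0\<^sub>m 1 m) (r * - (B * c) + D * 1\<^sub>m 1)"
    using A c r D Bc by (intro mult_four_block_mat) auto
  also have "\<dots> = four_block_mat A (0\<^sub>m m 1) r (r * - (B * c) + D)"
    unfolding z using A c r D by simp
  finally have "det (four_block_mat A c r D) * det ?N =
      det (four_block_mat A (0\<^sub>m m 1) r (r * - (B * c) + D))"
    using det_mult[OF M N] by simp
  moreover have "det ?N = 1"
    using Bc by (subst det_four_block_mat_lower_left_zero) auto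
  moreover have "det (four_block_mat A (0\<^sub>m m 1) r (r * - (B * c) + D)) =
      det A * det (r * - (B * c) + D)"
    using A r D Bc by (subst det_four_block_mat_upper_right_zero) auto
  moreover have "r * - (B * c) = - (r * (B * c))"
    by (rule uminus_mult_right_mat) (simp only: carrier_matD[OF r] carrier_matD[OF Bc])
  then have "det (r * - (B * c) + D) = D $$ (0, 0) - (r * (B * c)) $$ (0, 0)"
    using r D Bc by (subst det_single) auto
  ultimately show ?thesis by simp
qed

lemma semi_framed_det_eq:
  assumes B: "B \<in> carrier_mat (Suc n) (Suc n)"
    and TB: "mat (Suc n) (Suc n) (\<lambda>(j, k). fourier_coeff \<phi> (int j - int k)) * B = 1\<^sub>m (Suc n)"
  shows "semi_framed_det (n + 2) \<phi> c r a =
    toeplitz_det (n + 1) \<phi> * (a - (\<Sum>i\<le>n. \<Sum>j\<le>n. r j * B $$ (j, i) * c i))"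
proof -
  let ?T = "mat (Suc n) (Suc n) (\<lambda>(j, k). fourier_coeff \<phi> (int j - int k))"
  let ?c = "mat (Suc n) 1 (\<lambda>(j, k). c j)" and ?r = "mat 1 (Suc n) (\<lambda>(j, k). r k)"
  let ?a = "mat 1 1 (\<lambda>_. a)"
  have "semi_framed_det (n + 2) \<phi> c r a = det (four_block_mat ?T ?c ?r ?a)"
    unfolding semi_framed_det_def by (rule arg_cong[where f = det], rule eq_matI) auto
  also have "\<dots> = det ?T * (?a $$ (0, 0) - (?r * (B * ?c)) $$ (0, 0))"
    by (rule det_bordered[OF _ B _ _ _ TB]) auto
  also have "(?r * (B * ?c)) $$ (0, 0) = (\<Sum>j\<le>n. \<Sum>i\<le>n. r j * B $$ (j, i) * c i)"
    using B by (simp add: scalar_prod_def atLeast0LessThan lessThan_Suc_atMost sum_distrib_left mult_ac)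
  \<comment> \<open>The outer index now belongs to the column \<open>c\<close>, as it belongs to
    \<psi> in \<open>circle_integral_double_laurent\<close>.\<close>
  also have "\<dots> = (\<Sum>i\<le>n. \<Sum>j\<le>n. r j * B $$ (j, i) * c i)" by (rule sum.swap)
  finally show ?thesis by (simp add: toeplitz_det_def)
qed

text \<open>Expanding the orthogonality relations in Fourier coefficients of \<phi> gives
  \<open>?R * (?T * ?Q) = 1\<close>; it remains to move \<open>?R\<close> to the right.\<close>

lemma biorthogonal_toeplitz_inverse:
  assumes \<phi>: "L1_circle \<phi>" and bi: "biorthogonal_system \<phi> n Q Qh"
  shows "mat (Suc n) (Suc n) (\<lambda>(j, k). fourier_coeff \<phi> (int j - int k)) *
    mat (Suc n) (Suc n) (\<lambda>(j, i). \<Sum>k\<le>n. coeff (Q k) j * coeff (Qh k) i) = 1\<^sub>m (Suc n)"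
proof -
  let ?T = "mat (Suc n) (Suc n) (\<lambda>(j, k). fourier_coeff \<phi> (int j - int k))"
  let ?B = "mat (Suc n) (Suc n) (\<lambda>(j, i). \<Sum>k\<le>n. coeff (Q k) j * coeff (Qh k) i)"
  let ?Q = "mat (Suc n) (Suc n) (\<lambda>(j, k). coeff (Q k) j)"
  let ?R = "mat (Suc n) (Suc n) (\<lambda>(k, i). coeff (Qh k) i)"
  have pair: "(\<Sum>i\<le>n. \<Sum>j\<le>n. coeff (Qh m) i * (fourier_coeff \<phi> (int i - int j) * coeff (Q k) j)) =
      (if k = m then 1 else 0)" (is "?L = _") if "k \<le> n" "m \<le> n" for k m
  proof -
    have "degree (Q k) \<le> n" "degree (Qh m) \<le> n"
      using bi that by (auto simp: biorthogonal_system_def)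
    \<comment> \<open>Coefficients beyond the degree are 0, so summing up to \<open>n\<close> adds
      nothing and one matrix size serves all \<open>k\<close> and \<open>m\<close>.\<close>
    then have "?L = (\<Sum>i\<le>degree (Qh m). \<Sum>j\<le>degree (Q k).
        coeff (Qh m) i * (fourier_coeff \<phi> (int i - int j) * coeff (Q k) j))"
      by (intro sum.mono_neutral_cong_right) (auto simp: coeff_eq_0 not_le intro!: sum.neutral)
    also have "\<dots> = circle_integral (\<lambda>\<zeta>. poly (Q k) \<zeta> * poly (Qh m) (inverse \<zeta>) * \<phi> \<zeta>)"
      unfolding pairing_eq[OF \<phi>] by (subst sum.swap) (simp add: mult_ac)
    finally show ?thesis using bi that by (simp add: biorthogonal_system_def)
  qed
  have "?R * (?T * ?Q) = 1\<^sub>m (Suc n)"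
    by (rule eq_matI) (auto simp: scalar_prod_def atLeast0LessThan lessThan_Suc_atMost
      sum_distrib_left pair simp del: sum.atMost_Suc)
  \<comment> \<open>A left inverse of a square matrix is also a right inverse.\<close>
  then have "(?T * ?Q) * ?R = 1\<^sub>m (Suc n)"
    by (rule mat_mult_left_right_inverse[rotated 2]) auto
  moreover have "?Q * ?R = ?B"
    by (rule eq_matI) (auto simp: scalar_prod_def atLeast0LessThan lessThan_Suc_atMost)
  ultimately show ?thesis by (simp add: assoc_mult_mat[of _ "Suc n" "Suc n" _ "Suc n" _ "Suc n"])
qed

text \<open>Padding all polynomials to degree \<open>n\<close> and exchanging sums exhibits the
  entry \<open>(j, i)\<close> of the inverse Toeplitz matrix as the coefficient of
  \<open>w ^ j * z ^ i\<close>; \<open>w\<close> goes with \<open>Q\<close> and \<open>z\<close>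
  with \<open>Qh\<close>.\<close>

lemma reproducing_kernel_altdef:
  assumes "biorthogonal_system \<phi> n Q Qh"
  shows "reproducing_kernel Q Qh n z w =
    (\<Sum>i\<le>n. \<Sum>j\<le>n. (\<Sum>k\<le>n. coeff (Q k) j * coeff (Qh k) i) * w ^ j * z ^ i)"
proof -
  have deg: "degree (Q k) \<le> n" "degree (Qh k) \<le> n" if "k \<le> n" for k
    using assms that by (auto simp: biorthogonal_system_def)
  have p: "poly (Q k) w = (\<Sum>j\<le>n. coeff (Q k) j * w ^ j)"
    "poly (Qh k) z = (\<Sum>i\<le>n. coeff (Qh k) i * z ^ i)" if "k \<le> n" for k
    unfolding poly_altdef using deg[OF that]
    by (auto simp: le_degree intro!: sum.mono_neutral_left)
  have "reproducing_kernel Q Qh n z w =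
      (\<Sum>k\<le>n. (\<Sum>i\<le>n. coeff (Qh k) i * z ^ i) * (\<Sum>j\<le>n. coeff (Q k) j * w ^ j))"
    unfolding reproducing_kernel_def by (intro sum.cong refl) (simp add: p mult.commute)
  also have "\<dots> = (\<Sum>k\<le>n. \<Sum>i\<le>n. \<Sum>j\<le>n. coeff (Q k) j * coeff (Qh k) i * w ^ j * z ^ i)"
    unfolding sum_product by (simp add: mult_ac)
  also have "\<dots> = (\<Sum>i\<le>n. \<Sum>k\<le>n. \<Sum>j\<le>n. coeff (Q k) j * coeff (Qh k) i * w ^ j * z ^ i)"
    by (rule sum.swap)
  also have "\<dots> = (\<Sum>i\<le>n. \<Sum>j\<le>n. \<Sum>k\<le>n. coeff (Q k) j * coeff (Qh k) i * w ^ j * z ^ i)"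
    by (intro sum.cong refl sum.swap)
  finally show ?thesis by (simp add: sum_distrib_right)
qed

text \<open>The four cases of the theorem differ only in the exponents \<open>d\<close> and \<open>e\<close>.\<close>

lemma semi_framed_det_kernel:
  assumes \<phi>: "L1_circle \<phi>" and \<psi>: "L1_circle \<psi>" and \<eta>: "L1_circle \<eta>"
    and D: "toeplitz_det (n + 1) \<phi> \<noteq> 0" and bi: "biorthogonal_system \<phi> n Q Qh"
    and F: "\<And>z1 z2. z1 \<noteq> 0 \<Longrightarrow> z2 \<noteq> 0 \<Longrightarrow> F z1 z2 =
      (\<Sum>i\<le>n. \<Sum>j\<le>n. (\<Sum>k\<le>n. coeff (Q k) j * coeff (Qh k) i) * z2 powi e j * z1 powi d i)"
  shows "semi_framed_det (n + 2) \<phi> (\<lambda>i. fourier_coeff \<psi> (- d i)) (\<lambda>j. fourier_coeff \<eta> (- e j)) a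
      / toeplitz_det (n + 1) \<phi> =
    a - circle_integral (\<lambda>z1. circle_integral (\<lambda>z2. F z1 z2 * \<eta> z2) * \<psi> z1)"
proof -
  let ?G = "\<lambda>j i. \<Sum>k\<le>n. coeff (Q k) j * coeff (Qh k) i"
  have "circle_integral (\<lambda>z1. circle_integral (\<lambda>z2. F z1 z2 * \<eta> z2) * \<psi> z1) =
      circle_integral (\<lambda>z1. circle_integral (\<lambda>z2.
        (\<Sum>i\<le>n. \<Sum>j\<le>n. ?G j i * z2 powi e j * z1 powi d i) * \<eta> z2) * \<psi> z1)"
    \<comment> \<open>Applying the congruence to both integrals supplies the conditions
      \<open>z1 \<noteq> 0\<close> and \<open>z2 \<noteq> 0\<close> of \<open>F\<close>.\<close>
    by (intro circle_integral_cong arg_cong2[where f = "(*)"] refl F)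
  also have "\<dots> = (\<Sum>i\<le>n. \<Sum>j\<le>n. fourier_coeff \<eta> (- e j) * ?G j i * fourier_coeff \<psi> (- d i))"
    by (rule circle_integral_double_laurent[OF \<psi> \<eta>])
  finally show ?thesis
    using D by (subst semi_framed_det_eq[OF _ biorthogonal_toeplitz_inverse[OF \<phi> bi]]) auto
qed

theorem theorem1p13:
  fixes \<phi> \<psi> \<eta> :: "complex \<Rightarrow> complex" and a :: complex and n :: nat
    and Q Qh :: "nat \<Rightarrow> complex poly" and K :: "complex \<Rightarrow> complex \<Rightarrow> complex"
  assumes "L1_circle \<phi>" and "L1_circle \<psi>" and "L1_circle \<eta>"
    and "\<And>k. k \<le> n + 1 \<Longrightarrow> toeplitz_det k \<phi> \<noteq> 0"
    and "biorthogonal_system \<phi> n Q Qh"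
    and "K = reproducing_kernel Q Qh n"
  shows
    "framed_E (n + 2) \<phi> \<psi> \<eta> a / toeplitz_det (n + 1) \<phi> =
       a - circle_integral (\<lambda>z1.
             circle_integral (\<lambda>z2. K z1 z2 * z2 powi (- int n) * \<eta> z2)
               * z1 powi (- int n) * \<psi> z1) \<and>
     framed_G (n + 2) \<phi> \<psi> \<eta> a / toeplitz_det (n + 1) \<phi> =
       a - circle_integral (\<lambda>z1.
             circle_integral (\<lambda>z2. K (inverse z1) (inverse z2) * \<eta> z2) * \<psi> z1) \<and>
     framed_H (n + 2) \<phi> \<psi> \<eta> a / toeplitz_det (n + 1) \<phi> =
       a - circle_integral (\<lambda>z1.
             circle_integral (\<lambda>z2. K (inverse z1) z2 * z2 powi (- int n) * \<eta> z2) * \<psi> z1) \<and>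
     framed_L (n + 2) \<phi> \<psi> \<eta> a / toeplitz_det (n + 1) \<phi> =
       a - circle_integral (\<lambda>z1.
             circle_integral (\<lambda>z2. K z1 (inverse z2) * \<eta> z2)
               * z1 powi (- int n) * \<psi> z1)"
proof -
  let ?G = "\<lambda>j i. \<Sum>k\<le>n. coeff (Q k) j * coeff (Qh k) i"
  have K: "K z w = (\<Sum>i\<le>n. \<Sum>j\<le>n. ?G j i * w ^ j * z ^ i)" for z w
    unfolding assms(6) by (rule reproducing_kernel_altdef[OF assms(5)])
  have D: "toeplitz_det (n + 1) \<phi> \<noteq> 0" using assms(4) by simp
  note main = semi_framed_det_kernel[OF assms(1-3) D assms(5)]
  \<comment> \<open>This fails at 0 for \<open>i = n > 0\<close>, where the left side is 1 and the
    right side 0.\<close>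
  have shift: "z powi (int i - int n) = z ^ i * z powi (- int n)" if "z \<noteq> 0" for z :: complex and i
    using that by (simp add: power_int_diff power_int_minus divide_inverse)
  \<comment> \<open>This holds at 0 too, since \<open>inverse 0 = 0\<close>.\<close>
  have flip: "z powi (- int i) = inverse z ^ i" for z :: complex and i
    by (simp add: power_int_minus power_inverse)
  \<comment> \<open>The power of \<open>z1\<close> is constant for the inner integral and joins the
    kernel there. Arbitrary \<open>F\<close> is allowed because \<open>integral\<close> is 0 on
    non-integrable functions.\<close>
  have pull: "circle_integral (\<lambda>z1. circle_integral (\<lambda>z2. F z1 z2 * \<eta> z2) * z1 powi (- int n) * \<psi> z1) =
      circle_integral (\<lambda>z1. circle_integral (\<lambda>z2. (F z1 z2 * z1 powi (- int n)) * \<eta> z2) * \<psi> z1)" for F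
    by (simp add: circle_integral_eq flip: integral_mult_left)
      (simp add: mult_ac)
  show ?thesis
  proof (intro conjI)
    \<comment> \<open>Exponents \<open>j - n\<close> and \<open>i - n\<close> select the
      coefficients of index \<open>n - j\<close> and \<open>n - i\<close>, which is the reversed
      order of \<open>framed_E\<close> since \<open>N - 2 = n\<close>.\<close>
    have "K z1 z2 * z2 powi (- int n) * z1 powi (- int n) =
        (\<Sum>i\<le>n. \<Sum>j\<le>n. ?G j i * z2 powi (int j - int n) * z1 powi (int i - int n))"
      if "z1 \<noteq> 0" "z2 \<noteq> 0" for z1 z2
      using that by (simp add: K shift flip sum_distrib_left sum_distrib_right mult_ac)
    from main[OF this, of a]
    show "framed_E (n + 2) \<phi> \<psi> \<eta> a / toeplitz_det (n + 1) \<phi> =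
       a - circle_integral (\<lambda>z1.
             circle_integral (\<lambda>z2. K z1 z2 * z2 powi (- int n) * \<eta> z2) * z1 powi (- int n) * \<psi> z1)"
      by (simp add: framed_E_def pull)
    \<comment> \<open>Inverting both arguments gives exponents \<open>- j\<close> and
      \<open>- i\<close>, hence borders in increasing order.\<close>
    have "K (inverse z1) (inverse z2) =
        (\<Sum>i\<le>n. \<Sum>j\<le>n. ?G j i * z2 powi (- int j) * z1 powi (- int i))"
      if "z1 \<noteq> 0" "z2 \<noteq> 0" for z1 z2
      using that by (simp add: K shift flip sum_distrib_left sum_distrib_right mult_ac)
    from main[OF this, of a]
    show "framed_G (n + 2) \<phi> \<psi> \<eta> a / toeplitz_det (n + 1) \<phi> =
       a - circle_integral (\<lambda>z1.
             circle_integral (\<lambda>z2. K (inverse z1) (inverse z2) * \<eta> z2) * \<psi> z1)"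
      by (simp add: framed_G_def)
    \<comment> \<open>Only the last row, which carries \<eta>, is reversed here.\<close>
    have "K (inverse z1) z2 * z2 powi (- int n) =
        (\<Sum>i\<le>n. \<Sum>j\<le>n. ?G j i * z2 powi (int j - int n) * z1 powi (- int i))"
      if "z1 \<noteq> 0" "z2 \<noteq> 0" for z1 z2
      using that by (simp add: K shift flip sum_distrib_left sum_distrib_right mult_ac)
    from main[OF this, of a]
    show "framed_H (n + 2) \<phi> \<psi> \<eta> a / toeplitz_det (n + 1) \<phi> =
       a - circle_integral (\<lambda>z1.
             circle_integral (\<lambda>z2. K (inverse z1) z2 * z2 powi (- int n) * \<eta> z2) * \<psi> z1)"
      by (simp add: framed_H_def)
    \<comment> \<open>Only the last column, which carries \<psi>, is reversed here.\<close>
    have "K z1 (inverse z2) * z1 powi (- int n) =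
        (\<Sum>i\<le>n. \<Sum>j\<le>n. ?G j i * z2 powi (- int j) * z1 powi (int i - int n))"
      if "z1 \<noteq> 0" "z2 \<noteq> 0" for z1 z2
      using that by (simp add: K shift flip sum_distrib_left sum_distrib_right mult_ac)
    from main[OF this, of a]
    show "framed_L (n + 2) \<phi> \<psi> \<eta> a / toeplitz_det (n + 1) \<phi> =
       a - circle_integral (\<lambda>z1.
             circle_integral (\<lambda>z2. K z1 (inverse z2) * \<eta> z2) * z1 powi (- int n) * \<psi> z1)"
      by (simp add: framed_L_def pull)
  qed
qed

end
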